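(* Let $d\geqslant 1$ and $k\in\mathbb N_0$ be integers, let $\Omega\subset\mathbb R^d$ be a bounded open polyhedral set, $\mathcal T$ a conforming simplicial mesh of $\Omega$, and $\mathbb E$ a finite-dimensional real vector space with $m=\dim\mathbb E\geqslant1$, identified with $\mathbb R^m$ through a fixed basis. Let $M=\binom{d+k}{d}$. Suppose there is a point $\boldsymbol z\in\Omega$, lying on no mesh hyperplane, such that $$(1-t)\boldsymbol x+t\boldsymbol z\in\Omega\qquad\text{for every }\boldsymbol x\in\overline\Omega\text{ and }0<t\leqslant1.$$ Then $\mathrm{NN}_d^m(k;2H_{\mathcal T},MN_{\mathcal T})$ realizes $\mathcal V_k(\mathcal T;\mathbb E)$ pointwise on $\overline\Omega$: every $\boldsymbol v\in\mathcal V_k(\mathcal T;\mathbb E)$ agrees at every point of $\overline\Omega$ with some member of $\mathrm{NN}_d^m(k;2H_{\mathcal T},MN_{\mathcal T})$. The hidden parameters $\boldsymbol W_{\mathrm I},\boldsymbol b_{\mathrm I},\boldsymbol W_{\mathrm{II},0},\boldsymbol W_{\mathrm{II},1},\boldsymbol b_{\mathrm{II}}$ depend only on the mesh, the degree, and the choice of $\boldsymbol z$.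
   Context: Mesh. $\Omega\subset\mathbb R^d$ is a bounded open polyhedral set. A conforming simplicial mesh $\mathcal T=\{\tau_1,\dots,\tau_{N_{\mathcal T}}\}$ of $\Omega$ is a finite collection of pairwise disjoint open $d$-simplices $\tau_i\subset\Omega$ (elements) with $\bigcup_{\tau\in\mathcal T}\overline\tau=\overline\Omega$ such that for $i\neq j$ the set $\overline\tau_i\cap\overline\tau_j$ is either empty or a common subsimplex (face) of both. $N_{\mathcal T}$ is the number of elements. The mesh hyperplanes are the affine hyperplanes supporting the $(d-1)$-dimensional facets of elements, and $H_{\mathcal T}$ is the number of distinct unoriented mesh hyperplanes (coplanar facets contribute only once). Function space. $\mathcal V_k(\mathcal T;\mathbb E)$ is the space of $\boldsymbol v\in C(\overline\Omega;\mathbb E)$ such that for every $\tau\in\mathcal T$, $\boldsymbol v|_\tau$ is an $\mathbb E$-valued polynomial of total degree at most $k$. Networks. $\varrho_0(t)=\mathbf 1_{\{t>0\}}$ and $\varrho_j(t)=(\max\{t,0\})^j$ for $j\geqslant1$, applied componentwise to vectors. For positive integers $d,m,n_1,n_2$ and $k\in\mathbb N_0$, $\mathrm{NN}_d^m(k;n_1,n_2)$ is the class of functions $\mathbb R^d\to\mathbb R^m$ of the form $$\boldsymbol x\mapsto\boldsymbol W_{\mathrm{III}}\,\varrho_k\big(\boldsymbol W_{\mathrm{II},0}\varrho_0(\boldsymbol W_{\mathrm I}\boldsymbol x+\boldsymbol b_{\mathrm I})+\boldsymbol W_{\mathrm{II},1}\varrho_1(\boldsymbol W_{\mathrm I}\boldsymbol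 x+\boldsymbol b_{\mathrm I})+\boldsymbol b_{\mathrm{II}}\big)$$ with $\boldsymbol W_{\mathrm I}\in\mathbb R^{n_1\times d}$, $\boldsymbol b_{\mathrm I}\in\mathbb R^{n_1}$, $\boldsymbol W_{\mathrm{II},0},\boldsymbol W_{\mathrm{II},1}\in\mathbb R^{n_2\times n_1}$, $\boldsymbol b_{\mathrm{II}}\in\mathbb R^{n_2}$, $\boldsymbol W_{\mathrm{III}}\in\mathbb R^{m\times n_2}$. All parameters other than $\boldsymbol W_{\mathrm{III}}$ are called hidden parameters. The dependence statement means the hidden parameters can be chosen once, before $\boldsymbol v$, with only $\boldsymbol W_{\mathrm{III}}$ depending on $\boldsymbol v$. *)

theory Defs
  imports "HOL-Analysis.Analysis"
begin

text \<open>Ambient space: \<open>real ^ 'd\<close>, of dimension \<open>CARD('d) \<ge> 1\<close>.\<close>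

text \<open>The library notion \<^const>\<open>polyhedron\<close> is convex; a polyhedral set is a general finite union,
  up to closure.\<close>

definition polyhedral :: "(real ^ 'd) set \<Rightarrow> bool" where
  "polyhedral S \<longleftrightarrow> (\<exists>\<P>. finite \<P> \<and> (\<forall>P\<in>\<P>. polyhedron P) \<and> closure S = \<Union>\<P>)"

definition open_simplex :: "(real ^ 'd) set \<Rightarrow> bool" where
  "open_simplex \<tau> \<longleftrightarrow> (\<exists>S. int CARD('d) simplex S \<and> \<tau> = interior S)"

text \<open>The faces of a simplex in the sense of \<^const>\<open>face_of\<close> are the empty set and its
  subsimplices, so the last clause says that two closed elements are either disjoint or
  meet in a common subsimplex.\<close>

definition conforming_simplicial_mesh :: "(real ^ 'd) set \<Rightarrow> (real ^ 'd) set set \<Rightarrow> bool" where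
  "conforming_simplicial_mesh \<Omega> \<T> \<longleftrightarrow>
     finite \<T> \<and>
     (\<forall>\<tau>\<in>\<T>. open_simplex \<tau> \<and> \<tau> \<subseteq> \<Omega>) \<and>
     pairwise disjnt \<T> \<and>
     (\<Union>\<tau>\<in>\<T>. closure \<tau>) = closure \<Omega> \<and>
     pairwise (\<lambda>\<sigma> \<tau>. (closure \<sigma> \<inter> closure \<tau>) face_of closure \<sigma> \<and>
                      (closure \<sigma> \<inter> closure \<tau>) face_of closure \<tau>) \<T>"

definition mesh_hyperplanes :: "(real ^ 'd) set set \<Rightarrow> (real ^ 'd) set set" where
  "mesh_hyperplanes \<T> = {affine hull F |F \<tau>. \<tau> \<in> \<T> \<and> F facet_of closure \<tau>}"

text \<open>A finite-dimensional real vector space \<open>E\<close> is represented as a subspace of a normed space,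
  whose norm induces the canonical topology on \<open>E\<close>.  Polynomials are written out in monomials
  with exponents \<open>\<alpha>\<close> and coefficients in \<open>E\<close>.\<close>

definition multi_indices :: "nat \<Rightarrow> ('d::finite \<Rightarrow> nat) set" where
  "multi_indices k = {\<alpha>. (\<Sum>i\<in>UNIV. \<alpha> i) \<le> k}"

lemma finite_multi_indices: "finite (multi_indices k :: ('d::finite \<Rightarrow> nat) set)"
proof (rule finite_subset)
  show "(multi_indices k :: ('d \<Rightarrow> nat) set) \<subseteq> PiE UNIV (\<lambda>_. {..k})"
  proof
    fix \<alpha> :: "'d \<Rightarrow> nat" assume "\<alpha> \<in> multi_indices k"
    then have k: "sum \<alpha> UNIV \<le> k" by (simp add: multi_indices_def)
    have "\<alpha> i \<le> k" for i
      using member_le_sum[of i UNIV \<alpha>] k by simp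
    then show "\<alpha> \<in> PiE UNIV (\<lambda>_. {..k})" by (simp add: PiE_iff)
  qed
  show "finite (PiE (UNIV :: 'd set) (\<lambda>_. {..k}))"
    by (rule finite_PiE) simp_all
qed

definition polys_deg_le :: "nat \<Rightarrow> 'e::real_normed_vector set \<Rightarrow> (real ^ 'd \<Rightarrow> 'e) set" where
  "polys_deg_le k E = {p. \<exists>c. (\<forall>\<alpha>. c \<alpha> \<in> E) \<and>
     (\<forall>x. p x = (\<Sum>\<alpha>\<in>multi_indices k. (\<Prod>i\<in>UNIV. (x $ i) ^ \<alpha> i) *\<^sub>R c \<alpha>))}"

text \<open>Only the values on \<open>closure \<Omega>\<close> of a member are meaningful.\<close>

definition mesh_functions ::
  "(real ^ 'd) set \<Rightarrow> (real ^ 'd) set set \<Rightarrow> nat \<Rightarrow> 'e::real_normed_vector set \<Rightarrow> (real ^ 'd \<Rightarrow> 'e) set"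
  where
  "mesh_functions \<Omega> \<T> k E = {v. continuous_on (closure \<Omega>) v \<and> v ` closure \<Omega> \<subseteq> E \<and>
     (\<forall>\<tau>\<in>\<T>. \<exists>p\<in>polys_deg_le k E. \<forall>x\<in>\<tau>. v x = p x)}"

definition ordered_basis :: "'e::real_vector set \<Rightarrow> nat \<Rightarrow> (nat \<Rightarrow> 'e) \<Rightarrow> bool" where
  "ordered_basis E m e \<longleftrightarrow>
     inj_on e {..<m} \<and> independent (e ` {..<m}) \<and> span (e ` {..<m}) = E"

definition activation :: "nat \<Rightarrow> real \<Rightarrow> real" where
  "activation j t = (if j = 0 then (if t > 0 then 1 else 0) else (max t 0) ^ j)"

text \<open>Vectors and matrices of variable size are functions on \<open>nat\<close>, of which only the entries with
  indices below the layer widths \<open>n\<^sub>1\<close>, \<open>n\<^sub>2\<close> enter; \<open>W1 l\<close> is the \<open>l\<close>-th row of the first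
  weight matrix.  The output space \<open>\<real>\<^sup>m\<close> is \<open>{..<m} \<rightarrow>\<^sub>E UNIV\<close>.\<close>

definition network ::
  "nat \<Rightarrow> nat \<Rightarrow> nat \<Rightarrow> nat \<Rightarrow> (nat \<Rightarrow> real ^ 'd) \<Rightarrow> (nat \<Rightarrow> real) \<Rightarrow>
   (nat \<Rightarrow> nat \<Rightarrow> real) \<Rightarrow> (nat \<Rightarrow> nat \<Rightarrow> real) \<Rightarrow> (nat \<Rightarrow> real) \<Rightarrow>
   (nat \<Rightarrow> nat \<Rightarrow> real) \<Rightarrow> real ^ 'd \<Rightarrow> nat \<Rightarrow> real" where
  "network m k n\<^sub>1 n\<^sub>2 W1 b1 W20 W21 b2 W3 x =
     (\<lambda>i\<in>{..<m}. \<Sum>j<n\<^sub>2. W3 i j * activation k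
        ((\<Sum>l<n\<^sub>1. W20 j l * activation 0 (W1 l \<bullet> x + b1 l)) +
         (\<Sum>l<n\<^sub>1. W21 j l * activation 1 (W1 l \<bullet> x + b1 l)) + b2 j))"

definition NN :: "nat \<Rightarrow> nat \<Rightarrow> nat \<Rightarrow> nat \<Rightarrow> (real ^ 'd \<Rightarrow> nat \<Rightarrow> real) set" where
  "NN m k n\<^sub>1 n\<^sub>2 = {network m k n\<^sub>1 n\<^sub>2 W1 b1 W20 W21 b2 W3 |W1 b1 W20 W21 b2 W3. True}"

end

theory Submission
  imports Defs "HOL-Library.Function_Algebras"
begin

text \<open>
  From a point \<open>x\<close> of the closed domain, take a short step towards \<open>z\<close>.  It stays in the domain, and
  because \<open>z\<close> lies on no mesh hyperplane it ends on none, so it leads into exactly one open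
  element.  Sorting the points by this element partitions the closed domain into half-open cells
  (lemma \<open>half_open_cells_partition\<close>).  Orient all mesh hyperplanes so that \<open>a \<bullet> z > b\<close>.  Then a facet constraint of
  a cell reads either \<open>a \<bullet> x \<ge> b\<close> or \<open>a \<bullet> x < b\<close>, depending on whether the element is on the side of
  \<open>z\<close>, and both kinds are decided by the single indicator of \<open>a \<bullet> x < b\<close>.  Therefore the number of violated
  constraints of a cell is an affine combination of Heaviside neurons, one for each hyperplane
  (lemma \<open>violated_constraints\<close>).

  The ramps of the two orientations of a hyperplane differ by \<open>a \<bullet> x - b\<close>.  The normals of a bounded
  element span the space, so every affine form is an affine combination of these differences.
  A neuron of the second layer can thus receive \<open>l x - 2 * viol x\<close>, where \<open>viol x\<close> counts the violated
  constraints of a cell and \<open>l\<close> is an affine form with \<open>0 < l x \<le> 2\<close> on the closed domain.  The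
  activation of degree \<open>k\<close> turns this into \<open>(l x) ^ k\<close> on the cell and \<open>0\<close> on all others
  (lemmas \<open>ex_cell_neuron\<close> and \<open>activation_penalized\<close>).

  It remains to see that the powers \<open>l ^ k\<close> of \<open>M\<close> such forms, the same for all cells, span the
  polynomials of degree at most \<open>k\<close>.  Powers of \<open>1 + w \<bullet> x\<close> with small \<open>w\<close> do, by polarization, and
  \<open>M\<close> bounds the dimension (lemma \<open>ex_affine_powers_spanning_monomials\<close>).  On each cell the output weights then
  reproduce the polynomial that the mesh function equals on the closed element.
\<close>

section \<open>Polynomials as combinations of powers of affine forms\<close>

lemma (in vector_space) span_image_family:
  assumes "finite I" "v \<in> span (f ` I)"
  obtains c where "v = (\<Sum>i\<in>I. scale (c i) (f i))"
proof -
  obtain c where c: "v = (\<Sum>u\<in>f ` I. scale (c u) u)"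
    using assms span_finite[of "f ` I"] by auto
  \<comment> \<open>The family may repeat vectors; the coefficients go to one representative of each.\<close>
  obtain J where J: "J \<subseteq> I" "f ` I = f ` J" "inj_on f J"
    by (meson subset_image_inj order_refl)
  have "v = (\<Sum>i\<in>J. scale (c (f i)) (f i))"
    using J by (simp add: c sum.reindex)
  also have "\<dots> = (\<Sum>i\<in>I. scale (if i \<in> J then c (f i) else 0) (f i))"
    using assms(1) J(1) by (intro sum.mono_neutral_cong_left) auto
  finally show ?thesis by (rule that)
qed

text \<open>
  Real-valued functions form a vector space, so that the dimension bound for independent sets
  applies to spaces of polynomial functions.
\<close>

interpretation pointwise: vector_space "\<lambda>(c::real) (f::'a \<Rightarrow> real) x. c * f x"
  by standard (auto simp: fun_eq_iff algebra_simps)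

lemma sum_pointwise: "(\<Sum>i\<in>I. f i :: 'a \<Rightarrow> 'b::comm_monoid_add) x = (\<Sum>i\<in>I. f i x)"
  by (induction I rule: infinite_finite_induct) auto

text \<open>
  A polynomial curve inside a subspace has its coefficients there.  A Vandermonde argument would
  do; halving the parameter is shorter, because \<open>2 ^ n * F (t / 2) - F t\<close> has lower degree than
  \<open>F\<close> when \<open>F\<close> has degree \<open>n\<close>, and rescales each remaining coefficient by a nonzero factor.
\<close>

lemma power_coefficients_in_subspace:
  fixes f :: "nat \<Rightarrow> 'a \<Rightarrow> real"
  assumes S: "pointwise.subspace S" and "\<delta> > 0"
    and "\<And>t. 0 < t \<Longrightarrow> t \<le> \<delta> \<Longrightarrow> (\<lambda>x. \<Sum>n\<le>k. t ^ n * f n x) \<in> S"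
    and "n \<le> k"
  shows "f n \<in> S"
  using assms(3,4)
proof (induction k arbitrary: f n)
  case 0
  then show ?case using \<open>\<delta> > 0\<close> by fastforce
next
  case (Suc k)
  define F where "F t = (\<lambda>x. \<Sum>n\<le>Suc k. t ^ n * f n x)" for t
  have F: "F t \<in> S" if "0 < t" "t \<le> \<delta>" for t
    using Suc.prems(1) that unfolding F_def .
  have low: "f n \<in> S" if "n \<le> k" for n
  proof -
    define g where "g n = (\<lambda>x. (2 ^ (Suc k - n) - 1) * f n x)" for n
    have "(\<lambda>x. \<Sum>n\<le>k. t ^ n * g n x) \<in> S" if t: "0 < t" "t \<le> \<delta>" for t
    proof -
      \<comment> \<open>Comparing the parameters \<open>t\<close> and \<open>t / 2\<close> eliminates the top coefficient.\<close>
      have eq: "(2::real) ^ Suc k * (t / 2) ^ n - t ^ n = t ^ n * (2 ^ (Suc k - n) - 1)"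
        if "n \<le> Suc k" for n
        using that by (simp add: power_divide power_diff field_simps del: power_Suc)
      have "(\<lambda>x. 2 ^ Suc k * F (t / 2) x) - F t \<in> S"
        using S F[of "t / 2"] F[of t] t
        by (intro pointwise.subspace_diff pointwise.subspace_scale[OF S]) auto
      also have "(\<lambda>x. 2 ^ Suc k * F (t / 2) x) - F t
          = (\<lambda>x. \<Sum>n\<le>Suc k. (2 ^ Suc k * (t / 2) ^ n - t ^ n) * f n x)"
        by (simp add: F_def fun_eq_iff sum_distrib_left left_diff_distrib sum_subtractf mult.assoc
            del: sum.atMost_Suc power_Suc)
      also have "\<dots> = (\<lambda>x. \<Sum>n\<le>Suc k. t ^ n * (2 ^ (Suc k - n) - 1) * f n x)"
        by (intro ext sum.cong refl) (subst eq, auto)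
      also have "\<dots> = (\<lambda>x. \<Sum>n\<le>k. t ^ n * g n x)"
        by (simp add: g_def mult.assoc)
      finally show ?thesis .
    qed
    then have "g n \<in> S" using Suc.IH that by blast
    then have "(\<lambda>x. inverse (2 ^ (Suc k - n) - 1) * g n x) \<in> S"
      by (rule pointwise.subspace_scale[OF S])
    moreover have "(2::real) ^ (Suc k - n) \<noteq> 1"
      using that one_less_power[of "2::real" "Suc k - n"] by linarith
    then have "(\<lambda>x. inverse (2 ^ (Suc k - n) - 1) * g n x) = f n"
      by (simp add: g_def fun_eq_iff)
    ultimately show ?thesis by simp
  qed
  have "F \<delta> - (\<Sum>n\<le>k. (\<lambda>x. \<delta> ^ n * f n x)) \<in> S"
    using S F \<open>\<delta> > 0\<close> low
    by (intro pointwise.subspace_diff pointwise.subspace_sum pointwise.subspace_scale[OF S]) auto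
  then have "(\<lambda>x. inverse (\<delta> ^ Suc k) * (F \<delta> - (\<Sum>n\<le>k. (\<lambda>x. \<delta> ^ n * f n x))) x) \<in> S"
    by (rule pointwise.subspace_scale[OF S])
  also have "(\<lambda>x. inverse (\<delta> ^ Suc k) * (F \<delta> - (\<Sum>n\<le>k. (\<lambda>x. \<delta> ^ n * f n x))) x) = f (Suc k)"
    using \<open>\<delta> > 0\<close> by (simp add: F_def fun_eq_iff sum_pointwise del: power_Suc)
  finally show ?case using low Suc.prems(2) by (metis le_SucE)
qed

text \<open>
  Polarization one variable at a time.  As a function of \<open>w i\<close> alone the power is a polynomial
  curve, and its coefficients split off the powers of \<open>x $ i\<close> and leave an affine form in the
  remaining variables.  At \<open>I = UNIV\<close> only a monomial is left.
\<close>

lemma partial_monomial_in_subspace: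
  fixes S :: "(real ^ 'd \<Rightarrow> real) set"
  assumes S: "pointwise.subspace S" and "\<delta> > 0"
    and powers: "\<And>w :: 'd \<Rightarrow> real. (\<And>i. 0 < w i \<and> w i \<le> \<delta>) \<Longrightarrow>
      (\<lambda>x. (1 + (\<Sum>i\<in>UNIV. w i * x $ i)) ^ k) \<in> S"
    and "(\<Sum>i\<in>I. \<alpha> i) \<le> k" and "\<And>i. 0 < w i \<and> w i \<le> \<delta>"
  shows "(\<lambda>x. (\<Prod>i\<in>I. x $ i ^ \<alpha> i) *
      (1 + (\<Sum>i\<in>-I. w i * x $ i)) ^ (k - (\<Sum>i\<in>I. \<alpha> i))) \<in> S"
  using finite[of I] assms(4,5)
proof (induction I arbitrary: \<alpha> w rule: finite_induct)
  case empty
  then show ?case using powers by simp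
next
  case (insert i I)
  define n where "n = k - sum \<alpha> I"
  have \<alpha>: "sum \<alpha> I \<le> k" "\<alpha> i \<le> n" "k - sum \<alpha> (insert i I) = n - \<alpha> i"
    using insert.prems(1) insert.hyps by (auto simp: n_def)
  define A where "A x = 1 + (\<Sum>j\<in>-insert i I. w j * x $ j)" for x :: "real ^ 'd"
  define f where "f j = (\<lambda>x. real (n choose j) * ((\<Prod>i\<in>I. x $ i ^ \<alpha> i) * x $ i ^ j * A x ^ (n - j)))"
    for j
  have "f (\<alpha> i) \<in> S"
  proof (rule power_coefficients_in_subspace[OF S \<open>\<delta> > 0\<close>])
    fix t :: real assume t: "0 < t" "t \<le> \<delta>"
    have "1 + (\<Sum>j\<in>-I. (w(i := t)) j * x $ j) = t * x $ i + A x" for x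
    proof -
      have "-I = insert i (-insert i I)" using insert.hyps by auto
      then have "(\<Sum>j\<in>-I. (w(i := t)) j * x $ j)
          = t * x $ i + (\<Sum>j\<in>-insert i I. (w(i := t)) j * x $ j)"
        by (metis (no_types, lifting) ComplD finite fun_upd_same insertI1 sum.insert)
      also have "(\<Sum>j\<in>-insert i I. (w(i := t)) j * x $ j) = (\<Sum>j\<in>-insert i I. w j * x $ j)"
        by (intro sum.cong) auto
      finally show ?thesis by (simp add: A_def)
    qed
    moreover have "(\<lambda>x. (\<Prod>i\<in>I. x $ i ^ \<alpha> i) *
      (1 + (\<Sum>j\<in>-I. (w(i := t)) j * x $ j)) ^ (k - sum \<alpha> I)) \<in> S"
      using insert.IH[of \<alpha> "w(i := t)"] \<alpha> insert.prems t by simp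
    ultimately have "(\<lambda>x. (\<Prod>i\<in>I. x $ i ^ \<alpha> i) * (t * x $ i + A x) ^ n) \<in> S"
      by (simp add: n_def)
    also have "(\<lambda>x. (\<Prod>i\<in>I. x $ i ^ \<alpha> i) * (t * x $ i + A x) ^ n) = (\<lambda>x. \<Sum>j\<le>n. t ^ j * f j x)"
      by (simp add: binomial_ring f_def fun_eq_iff sum_distrib_left power_mult_distrib mult_ac)
    finally show "(\<lambda>x. \<Sum>j\<le>n. t ^ j * f j x) \<in> S" .
  qed (use \<alpha> in auto)
  then have "(\<lambda>x. inverse (real (n choose \<alpha> i)) * f (\<alpha> i) x) \<in> S"
    by (rule pointwise.subspace_scale[OF S])
  also have "(\<lambda>x. inverse (real (n choose \<alpha> i)) * f (\<alpha> i) x)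
     = (\<lambda>x. (\<Prod>i\<in>insert i I. x $ i ^ \<alpha> i) * A x ^ (n - \<alpha> i))"
    using \<alpha>(2) insert.hyps by (simp add: f_def fun_eq_iff mult_ac)
  finally show ?case using \<alpha>(3) by (simp add: A_def)
qed

definition monomial :: "('d::finite \<Rightarrow> nat) \<Rightarrow> real ^ 'd \<Rightarrow> real" where
  "monomial \<alpha> x = (\<Prod>i\<in>UNIV. x $ i ^ \<alpha> i)"

lemma monomial_times_coordinate:
  "monomial \<alpha> x * x $ i = monomial (\<alpha>(i := Suc (\<alpha> i))) x"
  by (simp add: monomial_def prod.remove[of UNIV i] mult_ac)

text \<open>
  This bounds the dimension of the span of the affine powers, and so lets a number of them equal to
  the number of monomials suffice.
\<close>

lemma affine_power_in_span_monomials: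
  fixes w :: "real ^ 'd"
  shows "(\<lambda>x. (1 + w \<bullet> x) ^ k) \<in> pointwise.span (monomial ` multi_indices k)"
proof (induction k)
  case 0
  have "(\<lambda>x. 1) = (monomial (\<lambda>_. 0) :: real ^ 'd \<Rightarrow> real)"
    by (auto simp: monomial_def)
  then show ?case
    by (auto intro!: pointwise.span_base simp: multi_indices_def)
next
  case (Suc k)
  let ?P = "\<lambda>k. pointwise.span (monomial ` multi_indices k :: (real ^ 'd \<Rightarrow> real) set)"
  have mono: "?P k \<subseteq> ?P (Suc k)"
    by (intro pointwise.span_mono image_mono) (auto simp: multi_indices_def)
  have coord: "(\<lambda>x. f x * x $ i) \<in> ?P (Suc k)" if "f \<in> ?P k" for f i
    using that
  proof (induction rule: pointwise.span_induct_alt)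
    case base
    show ?case using pointwise.span_zero by (simp add: zero_fun_def)
  next
    case (step c f g)
    then obtain \<alpha> where \<alpha>: "\<alpha> \<in> multi_indices k" "f = monomial \<alpha>" by blast
    have "\<alpha>(i := Suc (\<alpha> i)) \<in> multi_indices (Suc k)"
      using \<alpha>(1) by (simp add: multi_indices_def sum.remove[of UNIV i])
    then have "(\<lambda>x. f x * x $ i) \<in> ?P (Suc k)"
      by (auto simp: \<alpha>(2) monomial_times_coordinate intro!: pointwise.span_base)
    then have "(\<lambda>x. c * (f x * x $ i)) + (\<lambda>x. g x * x $ i) \<in> ?P (Suc k)"
      by (intro pointwise.span_add pointwise.span_scale step.IH)
    then show ?case by (simp add: plus_fun_def algebra_simps)
  qed
  let ?f = "\<lambda>x. (1 + w \<bullet> x) ^ k"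
  have "?f + (\<Sum>i\<in>UNIV. (\<lambda>x. w $ i * (?f x * x $ i))) \<in> ?P (Suc k)"
    using Suc mono coord
    by (intro pointwise.span_add pointwise.span_sum pointwise.span_scale) auto
  also have "?f + (\<Sum>i\<in>UNIV. (\<lambda>x. w $ i * (?f x * x $ i))) = (\<lambda>x. (1 + w \<bullet> x) ^ Suc k)"
    by (simp add: fun_eq_iff sum_pointwise inner_vec_def algebra_simps sum_distrib_left)
  finally show ?case .
qed

text \<open>
  Splitting off the exponent of one variable gives the hockey-stick sum for binomial
  coefficients.
\<close>

lemma card_multi_indices_le:
  "card (multi_indices k :: ('d::finite \<Rightarrow> nat) set) \<le> (CARD('d) + k) choose CARD('d)"
proof -
  have "finite A \<and> card A \<le> (card I + k) choose card I"
    if "A = {\<alpha>. (\<forall>i. i \<notin> I \<longrightarrow> \<alpha> i = 0) \<and> sum \<alpha> I \<le> k}"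
    for A and I :: "'d set"
    using finite[of I] that
  proof (induction I arbitrary: A k rule: finite_induct)
    case empty
    then have "A = {\<lambda>_. 0}" by auto
    then show ?case by simp
  next
    case (insert i I)
    define B where "B k = {\<alpha>. (\<forall>i. i \<notin> I \<longrightarrow> \<alpha> i = (0::nat)) \<and> sum \<alpha> I \<le> k}" for k
    have B: "finite (B k) \<and> card (B k) \<le> (card I + k) choose card I" for k
      using insert.IH by (simp add: B_def)
    have "A \<subseteq> (\<Union>j\<le>k. (\<lambda>\<alpha>. \<alpha>(i := j)) ` B (k - j))"
    proof
      fix \<alpha> assume "\<alpha> \<in> A"
      then have \<alpha>: "\<And>j. j \<notin> insert i I \<Longrightarrow> \<alpha> j = 0" "\<alpha> i + sum \<alpha> I \<le> k"
        using insert by auto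
      have "sum (\<alpha>(i := 0)) I = sum \<alpha> I"
        using insert.hyps by (intro sum.cong) auto
      then have "\<alpha>(i := 0) \<in> B (k - \<alpha> i)"
        using \<alpha> by (auto simp: B_def)
      then have "\<alpha> \<in> (\<lambda>\<alpha>'. \<alpha>'(i := \<alpha> i)) ` B (k - \<alpha> i)"
        by (intro image_eqI) auto
      then show "\<alpha> \<in> (\<Union>j\<le>k. (\<lambda>\<alpha>. \<alpha>(i := j)) ` B (k - j))"
        using \<alpha>(2) by (intro UN_I[of "\<alpha> i"]) auto
    qed
    moreover have fin: "finite (\<Union>j\<le>k. (\<lambda>\<alpha>. \<alpha>(i := j)) ` B (k - j))"
      using B by auto
    ultimately have "finite A" "card A \<le> card (\<Union>j\<le>k. (\<lambda>\<alpha>. \<alpha>(i := j)) ` B (k - j))"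
      by (auto intro: finite_subset card_mono)
    note this(2)
    also have "\<dots> \<le> (\<Sum>j\<le>k. card ((\<lambda>\<alpha>. \<alpha>(i := j)) ` B (k - j)))"
      by (rule card_UN_le) simp
    also have "\<dots> \<le> (\<Sum>j\<le>k. (card I + (k - j)) choose card I)"
      using B card_image_le order_trans by (intro sum_mono) blast
    also have "\<dots> = (\<Sum>j\<le>k. (card I + j) choose card I)"
      using sum.nat_diff_reindex[of "\<lambda>j. (card I + j) choose card I" "Suc k"]
      by (simp add: lessThan_Suc_atMost del: sum.lessThan_Suc)
    also have "\<dots> = (card (insert i I) + k) choose card (insert i I)"
      using insert.hyps choose_rising_sum(1)[of "card I" k] by simp
    finally show ?case using \<open>finite A\<close> by simp
  qed
  from this[of _ UNIV] show ?thesis by (simp add: multi_indices_def)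
qed

text \<open>
  The powers \<open>(1 + w \<bullet> x) ^ k\<close> with \<open>w\<close> in an arbitrarily small box span all polynomials of degree
  at most \<open>k\<close>, and a basis among them has at most as many members as there are monomials.  The
  smallness of \<open>w\<close> serves to keep \<open>1 + w \<bullet> x\<close> positive on a bounded set.
\<close>

lemma ex_affine_powers_spanning_monomials:
  fixes k :: nat
  assumes "\<delta> > 0"
  shows "\<exists>w :: nat \<Rightarrow> real ^ 'd. (\<forall>j i. \<bar>w j $ i\<bar> \<le> \<delta>) \<and>
    (\<forall>\<alpha>\<in>multi_indices k. \<exists>c. \<forall>x.
      monomial \<alpha> x = (\<Sum>j<(CARD('d) + k) choose CARD('d). c j * (1 + w j \<bullet> x) ^ k))"
proof -
  define M where "M = (CARD('d) + k) choose CARD('d)"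
  define W where "W = {w :: real ^ 'd. \<forall>i. 0 < w $ i \<and> w $ i \<le> \<delta>}"
  define pow where "pow w = (\<lambda>x. (1 + w \<bullet> x) ^ k)" for w :: "real ^ 'd"
  obtain B where B: "B \<subseteq> pow ` W" "pointwise.independent B" "pow ` W \<subseteq> pointwise.span B"
    by (rule pointwise.maximal_independent_subset)
  have monomials: "monomial \<alpha> \<in> pointwise.span B" if "\<alpha> \<in> multi_indices k" for \<alpha> :: "'d \<Rightarrow> nat"
  proof -
    have "(\<lambda>x. (\<Prod>i\<in>UNIV. x $ i ^ \<alpha> i) *
        (1 + (\<Sum>i\<in>-UNIV. \<delta> * x $ i)) ^ (k - (\<Sum>i\<in>UNIV. \<alpha> i))) \<in> pointwise.span B"
    proof (rule partial_monomial_in_subspace[OF pointwise.subspace_span assms])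
      fix w :: "'d \<Rightarrow> real" assume w: "\<And>i. 0 < w i \<and> w i \<le> \<delta>"
      have "(\<chi> i. w i) \<in> W" using w by (simp add: W_def)
      then have "pow (\<chi> i. w i) \<in> pointwise.span B" using B(3) by blast
      then show "(\<lambda>x. (1 + (\<Sum>i\<in>UNIV. w i * x $ i)) ^ k) \<in> pointwise.span B"
        by (simp add: pow_def inner_vec_def)
    qed (use that assms in \<open>auto simp: multi_indices_def\<close>)
    then show ?thesis by (simp add: monomial_def[abs_def])
  qed
  have "pow ` W \<subseteq> pointwise.span (monomial ` multi_indices k)"
    using affine_power_in_span_monomials by (auto simp: pow_def)
  then have "B \<subseteq> pointwise.span (monomial ` multi_indices k)"
    using B(1) by blast
  then have bound: "finite B" "card B \<le> card (monomial ` (multi_indices k :: ('d \<Rightarrow> nat) set))"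
    using pointwise.independent_span_bound[OF finite_imageI[OF finite_multi_indices] B(2)] by auto
  note this(2)
  also have "\<dots> \<le> M"
    unfolding M_def
    using card_image_le[OF finite_multi_indices] card_multi_indices_le order_trans by blast
  finally have "card B \<le> M" .
  obtain V where V: "V \<subseteq> W" "B = pow ` V" "inj_on pow V"
    by (metis B(1) subset_image_inj)
  have "finite V" "card V \<le> M"
    using V bound(1) \<open>card B \<le> M\<close> by (auto simp: card_image finite_image_iff)
  obtain v where v: "bij_betw v {..<card V} V"
    using ex_bij_betw_nat_finite[OF \<open>finite V\<close>] by (auto simp: lessThan_atLeast0)
  \<comment> \<open>The family is padded to length \<open>M\<close> by an arbitrary admissible direction.\<close>
  define w where "w j = (if j < card V then v j else (\<chi> i. \<delta>))" for j
  show ?thesis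
  proof (intro exI[of _ w] conjI allI ballI)
    fix j i
    have "w j \<in> W"
      using v V(1) \<open>\<delta> > 0\<close> by (auto simp: w_def W_def dest: bij_betwE)
    then show "\<bar>w j $ i\<bar> \<le> \<delta>" by (simp add: W_def abs_of_pos)
  next
    fix \<alpha> :: "'d \<Rightarrow> nat" assume "\<alpha> \<in> multi_indices k"
    have "v ` {..<card V} \<subseteq> w ` {..<M}"
      using \<open>card V \<le> M\<close> by (force simp: w_def)
    then have "V \<subseteq> w ` {..<M}"
      using v by (simp add: bij_betw_def)
    then have "B \<subseteq> (\<lambda>j. pow (w j)) ` {..<M}"
      using V(2) by auto
    then have "monomial \<alpha> \<in> pointwise.span ((\<lambda>j. pow (w j)) ` {..<M})"
      using monomials[OF \<open>\<alpha> \<in> multi_indices k\<close>] pointwise.span_mono by blast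
    then obtain c where "monomial \<alpha> = (\<Sum>j<M. (\<lambda>x. c j * pow (w j) x))"
      by (rule pointwise.span_image_family[OF finite_lessThan])
    then have "\<forall>x. monomial \<alpha> x = (\<Sum>j<M. c j * pow (w j) x)"
      by (simp add: sum_pointwise)
    then show "\<exists>c. \<forall>x. monomial \<alpha> x =
        (\<Sum>j<(CARD('d) + k) choose CARD('d). c j * (1 + w j \<bullet> x) ^ k)"
      unfolding M_def pow_def by blast
  qed
qed

text \<open>
  The directions \<open>w\<close> depend on neither the polynomial nor the space of its values: only the
  coefficients \<open>C\<close> do.  They become the output weights.
\<close>

lemma poly_as_affine_powers:
  fixes w :: "nat \<Rightarrow> real ^ 'd" and e :: "nat \<Rightarrow> 'e::real_normed_vector"
  assumes w: "\<And>\<alpha>. \<alpha> \<in> multi_indices k \<Longrightarrow>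
      \<exists>c. \<forall>x. monomial \<alpha> x = (\<Sum>j<M. c j * (1 + w j \<bullet> x) ^ k)"
    and e: "ordered_basis E m e" and p: "p \<in> polys_deg_le k E"
  shows "\<exists>C. \<forall>x. p x = (\<Sum>i<m. (\<Sum>j<M. C i j * (1 + w j \<bullet> x) ^ k) *\<^sub>R e i)"
proof -
  obtain c where c: "\<And>\<alpha>. c \<alpha> \<in> E"
      "\<And>x. p x = (\<Sum>\<alpha>\<in>multi_indices k. monomial \<alpha> x *\<^sub>R c \<alpha>)"
    using p by (auto simp: polys_deg_le_def monomial_def)
  have "\<exists>u. c \<alpha> = (\<Sum>i<m. u i *\<^sub>R e i)" for \<alpha>
    using real_vector.span_image_family[of "{..<m}" "c \<alpha>" e] c(1) e
    by (auto simp: ordered_basis_def)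
  then obtain u where u: "\<And>\<alpha>. c \<alpha> = (\<Sum>i<m. u \<alpha> i *\<^sub>R e i)" by metis
  obtain D where D: "\<And>\<alpha> x. \<alpha> \<in> multi_indices k \<Longrightarrow>
      monomial \<alpha> x = (\<Sum>j<M. D \<alpha> j * (1 + w j \<bullet> x) ^ k)"
    using w by metis
  show ?thesis
  proof (intro exI[of _ "\<lambda>i j. \<Sum>\<alpha>\<in>multi_indices k. u \<alpha> i * D \<alpha> j"] allI)
    fix x
    have coeff: "(\<Sum>\<alpha>\<in>multi_indices k. u \<alpha> i * monomial \<alpha> x)
        = (\<Sum>j<M. (\<Sum>\<alpha>\<in>multi_indices k. u \<alpha> i * D \<alpha> j) * (1 + w j \<bullet> x) ^ k)" for i
    proof -
      have "(\<Sum>\<alpha>\<in>multi_indices k. u \<alpha> i * monomial \<alpha> x)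
          = (\<Sum>\<alpha>\<in>multi_indices k. \<Sum>j<M. u \<alpha> i * D \<alpha> j * (1 + w j \<bullet> x) ^ k)"
        by (intro sum.cong refl) (simp add: D sum_distrib_left mult.assoc)
      also have "\<dots> = (\<Sum>j<M. (\<Sum>\<alpha>\<in>multi_indices k. u \<alpha> i * D \<alpha> j) * (1 + w j \<bullet> x) ^ k)"
        by (subst sum.swap) (simp add: sum_distrib_right)
      finally show ?thesis .
    qed
    have "p x = (\<Sum>\<alpha>\<in>multi_indices k. \<Sum>i<m. (u \<alpha> i * monomial \<alpha> x) *\<^sub>R e i)"
      unfolding c(2) by (simp add: u scaleR_sum_right mult.commute)
    also have "\<dots> = (\<Sum>i<m. (\<Sum>\<alpha>\<in>multi_indices k. u \<alpha> i * monomial \<alpha> x) *\<^sub>R e i)"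
      by (subst sum.swap) (simp add: scaleR_sum_left)
    finally show "p x = (\<Sum>i<m. (\<Sum>j<M. (\<Sum>\<alpha>\<in>multi_indices k. u \<alpha> i * D \<alpha> j)
        * (1 + w j \<bullet> x) ^ k) *\<^sub>R e i)"
      unfolding coeff .
  qed
qed


section \<open>Facet hyperplanes of polyhedra\<close>

lemma affine_hull_of_facet:
  fixes S :: "'a::euclidean_space set"
  assumes "aff_dim S = int DIM('a)" "C facet_of S" "C \<subseteq> {x. a \<bullet> x = b}" "a \<noteq> 0"
  shows "affine hull C = {x. a \<bullet> x = b}"
proof (rule affine_dim_equal)
  show "affine hull C \<subseteq> {x. a \<bullet> x = b}"
    using assms(3) by (simp add: affine_hyperplane hull_minimal)
  show "aff_dim (affine hull C) = aff_dim {x. a \<bullet> x = b}"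
    using assms by (simp add: facet_of_def aff_dim_hyperplane)
  show "affine hull C \<noteq> {}"
    using assms(2) by (simp add: facet_of_def)
qed (auto simp: affine_hyperplane)

text \<open>
  A facet hyperplane comes with one normal from the polyhedron and another one fixed for the whole
  mesh; this makes the two comparable.
\<close>

lemma same_hyperplane_proportional:
  fixes a :: "'a::euclidean_space"
  assumes "{x. a \<bullet> x = b} = {x. a' \<bullet> x = b'}" "a \<noteq> 0" "a' \<noteq> 0"
  obtains c where "c \<noteq> 0" "a' = c *\<^sub>R a" "b' = c * b"
proof -
  define q where "q = (b / (a \<bullet> a)) *\<^sub>R a"
  have q: "a \<bullet> q = b" using assms(2) by (simp add: q_def)
  then have q': "a' \<bullet> q = b'" using assms(1) by blast
  define c where "c = (a' \<bullet> a) / (a \<bullet> a)"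
  \<comment> \<open>The component of \<open>a'\<close> orthogonal to \<open>a\<close> is parallel to the hyperplane, so it is orthogonal to
      \<open>a'\<close> as well and vanishes.\<close>
  define v where "v = a' - c *\<^sub>R a"
  have "a \<bullet> v = 0"
    using assms(2) by (simp add: v_def c_def inner_diff_right inner_commute)
  moreover from this have "q + v \<in> {x. a \<bullet> x = b}"
    using q by (simp add: inner_right_distrib)
  then have "a' \<bullet> v = 0"
    unfolding assms(1) using q' by (simp add: inner_right_distrib)
  ultimately have "v \<bullet> v = 0"
    by (simp add: v_def inner_diff_left)
  then have "a' = c *\<^sub>R a" by (simp add: v_def)
  moreover from this have "b' = c * b" using q q' by simp
  ultimately show ?thesis using that assms(3) by force
qed

text \<open>
  The half-spaces that bound a full-dimensional polyhedron are described through an interior point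
  \<open>p\<close>, so that any choice of normals of the facet hyperplanes can be used, whichever way they point:
  a point belongs to the polyhedron when it lies on the same side as \<open>p\<close> of each hyperplane.
\<close>

lemma full_dim_polyhedron_sides:
  fixes S :: "'a::euclidean_space set" and a :: "'a set \<Rightarrow> 'a" and b :: "'a set \<Rightarrow> real"
  assumes S: "polyhedron S" "p \<in> interior S"
    and G: "G = {affine hull C |C. C facet_of S}"
    and ab: "\<And>g. g \<in> G \<Longrightarrow> a g \<noteq> 0 \<and> g = {x. a g \<bullet> x = b g}"
  shows "S = {x. \<forall>g\<in>G. 0 \<le> (a g \<bullet> p - b g) * (a g \<bullet> x - b g)}"
    and "interior S = {x. \<forall>g\<in>G. 0 < (a g \<bullet> p - b g) * (a g \<bullet> x - b g)}"
proof -
  have dim: "aff_dim S = int DIM('a)"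
    using S(2) aff_dim_nonempty_interior by blast
  then have hull: "affine hull S = UNIV"
    using aff_dim_eq_full by blast
  from S(1) obtain F where *: "finite F \<and> S = affine hull S \<inter> \<Inter>F \<and>
      (\<forall>h\<in>F. \<exists>a b. a \<noteq> 0 \<and> h = {x. a \<bullet> x \<le> b}) \<and>
      (\<forall>F'. F' \<subset> F \<longrightarrow> S \<subset> affine hull S \<inter> \<Inter>F')"
    unfolding polyhedron_Int_affine_minimal by (rule exE)
  \<comment> \<open>The equation for \<open>S\<close> has \<open>S\<close> on both sides, so the conjuncts are extracted without rewriting.\<close>
  note F = *[THEN conjunct1] *[THEN conjunct2, THEN conjunct1]
    *[THEN conjunct2, THEN conjunct2, THEN conjunct2, rule_format]
  from *[THEN conjunct2, THEN conjunct2, THEN conjunct1]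
  obtain a' b' where ab': "\<And>h. h \<in> F \<Longrightarrow> a' h \<noteq> 0 \<and> h = {x. a' h \<bullet> x \<le> b' h}"
    by metis
  have S_eq: "S = {x. \<forall>h\<in>F. a' h \<bullet> x \<le> b' h}"
    unfolding F(2)[unfolded hull] using ab' by auto
  have int_eq: "interior S = {x. \<forall>h\<in>F. a' h \<bullet> x < b' h}"
    using rel_interior_polyhedron_explicit[OF F(1,2) ab' F(3)] interior_rel_interior[OF dim] S_eq
    by (fastforce intro: less_imp_le)
  have facet: "C facet_of S \<longleftrightarrow> (\<exists>h\<in>F. C = S \<inter> {x. a' h \<bullet> x = b' h})" for C
    using facet_of_polyhedron_explicit[OF F(1,2) ab' F(3)] by blast
  have "affine hull (S \<inter> {x. a' h \<bullet> x = b' h}) = {x. a' h \<bullet> x = b' h}" if "h \<in> F" for h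
    using affine_hull_of_facet[OF dim] facet ab' that by blast
  then have G_eq: "G = (\<lambda>h. {x. a' h \<bullet> x = b' h}) ` F"
    unfolding G using facet by (auto simp: image_iff)
  have *: "(a' h \<bullet> x \<le> b' h \<longleftrightarrow> 0 \<le> (a g \<bullet> p - b g) * (a g \<bullet> x - b g)) \<and>
      (a' h \<bullet> x < b' h \<longleftrightarrow> 0 < (a g \<bullet> p - b g) * (a g \<bullet> x - b g))"
    if h: "h \<in> F" and g: "g = {x. a' h \<bullet> x = b' h}" for h g x
  proof -
    have "g \<in> G" using h g G_eq by blast
    then obtain c where c: "c \<noteq> 0" "a' h = c *\<^sub>R a g" "b' h = c * b g"
      using same_hyperplane_proportional[of "a g" "b g" "a' h" "b' h"] ab ab' h g by metis
    have "c * (a g \<bullet> p - b g) < 0"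
      using S(2) h c int_eq by (auto simp: algebra_simps)
    moreover have "a' h \<bullet> x \<le> b' h \<longleftrightarrow> c * (a g \<bullet> x - b g) \<le> 0"
        "a' h \<bullet> x < b' h \<longleftrightarrow> c * (a g \<bullet> x - b g) < 0"
      using c by (auto simp: algebra_simps)
    ultimately show ?thesis
      by (auto simp: mult_less_0_iff zero_less_mult_iff mult_le_0_iff zero_le_mult_iff)
  qed
  show "S = {x. \<forall>g\<in>G. 0 \<le> (a g \<bullet> p - b g) * (a g \<bullet> x - b g)}"
    using * unfolding S_eq G_eq by auto
  show "interior S = {x. \<forall>g\<in>G. 0 < (a g \<bullet> p - b g) * (a g \<bullet> x - b g)}"
    using * unfolding int_eq G_eq by auto
qed

text \<open>
  A vector orthogonal to all normals would be a direction in which the set is unbounded.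
\<close>

lemma bounded_normals_span:
  fixes a :: "'b \<Rightarrow> 'a::euclidean_space"
  assumes "bounded {x. \<forall>g\<in>G. 0 \<le> (a g \<bullet> p - b g) * (a g \<bullet> x - b g)}"
  shows "span (a ` G) = UNIV"
proof (rule ccontr)
  assume "span (a ` G) \<noteq> UNIV"
  then obtain u where u: "u \<noteq> 0" "\<And>g. g \<in> G \<Longrightarrow> u \<bullet> a g = 0"
    using span_not_UNIV_orthogonal by (metis imageI span_base)
  obtain B where B: "\<And>x. \<forall>g\<in>G. 0 \<le> (a g \<bullet> p - b g) * (a g \<bullet> x - b g) \<Longrightarrow> norm x \<le> B"
    using assms by (auto simp: bounded_iff)
  define t where "t = (B + norm p + 1) / norm u"
  have "norm (p + t *\<^sub>R u) \<le> B"
    by (rule B) (use u(2) in \<open>auto simp: inner_right_distrib inner_commute\<close>)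
  moreover have "norm (t *\<^sub>R u) = \<bar>B + norm p + 1\<bar>"
    using u(1) by (simp add: t_def)
  moreover have "norm (t *\<^sub>R u) \<le> norm (p + t *\<^sub>R u) + norm p"
    using norm_triangle_ineq4[of "p + t *\<^sub>R u" p] by simp
  ultimately show False by linarith
qed


section \<open>Elements, hyperplanes and functions of a mesh\<close>

lemma mesh_element:
  fixes \<T> :: "(real ^ 'd) set set"
  assumes "conforming_simplicial_mesh \<Omega> \<T>" "\<tau> \<in> \<T>"
  shows "polyhedron (closure \<tau>)" "interior (closure \<tau>) = \<tau>" "\<tau> \<noteq> {}" "bounded (closure \<tau>)"
proof -
  obtain S where S: "int CARD('d) simplex S" "\<tau> = interior S"
    using assms by (auto simp: conforming_simplicial_mesh_def open_simplex_def)
  have "polytope S" using S(1) by (rule simplex_imp_polytope)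
  then have "convex S" "closed S" "bounded S"
    by (simp_all add: polytope_imp_convex polytope_imp_closed polytope_imp_bounded)
  have "aff_dim S = int DIM(real ^ 'd)"
    using aff_dim_simplex[OF S(1)] by simp
  then have "interior S \<noteq> {}"
    using \<open>convex S\<close> aff_dim_empty interior_rel_interior rel_interior_eq_empty
    by (metis aff_dim_empty_eq of_nat_0_le_iff neg_0_le_iff_le not_one_le_zero)
  moreover from this have "closure \<tau> = S"
    using convex_closure_interior[OF \<open>convex S\<close>] \<open>closed S\<close> S(2) by simp
  ultimately show "polyhedron (closure \<tau>)" "interior (closure \<tau>) = \<tau>" "\<tau> \<noteq> {}" "bounded (closure \<tau>)"
    using S \<open>bounded S\<close> \<open>polytope S\<close> by (simp_all add: polytope_imp_polyhedron)
qed

lemma mesh_hyperplanes_eq: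
  "mesh_hyperplanes \<T> = (\<Union>\<tau>\<in>\<T>. {affine hull F |F. F facet_of closure \<tau>})"
  by (auto simp: mesh_hyperplanes_def)

lemma finite_mesh_hyperplanes:
  assumes "conforming_simplicial_mesh \<Omega> \<T>"
  shows "finite (mesh_hyperplanes \<T>)"
proof -
  have "finite {affine hull F |F. F facet_of closure \<tau>}" if "\<tau> \<in> \<T>" for \<tau>
    using finite_polyhedron_facets[OF mesh_element(1)[OF assms that]] by (simp add: setcompr_eq_image)
  then show ?thesis
    using assms by (auto simp: mesh_hyperplanes_eq conforming_simplicial_mesh_def)
qed

text \<open>
  Since \<open>z\<close> lies on no mesh hyperplane, every normal can be chosen to point towards \<open>z\<close>.
\<close>

lemma mesh_hyperplane_oriented:
  assumes "conforming_simplicial_mesh \<Omega> \<T>" "h \<in> mesh_hyperplanes \<T>" "z \<notin> h"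
  obtains a b where "a \<noteq> 0" "h = {x. a \<bullet> x = b}" "b < a \<bullet> z"
proof -
  obtain F \<tau> where F: "h = affine hull F" "\<tau> \<in> \<T>" "F facet_of closure \<tau>"
    using assms(2) by (auto simp: mesh_hyperplanes_def)
  note \<tau> = mesh_element[OF assms(1) F(2)]
  obtain a b where ab: "a \<noteq> 0" "F = closure \<tau> \<inter> {x. a \<bullet> x = b}"
    using facet_of_polyhedron[OF \<tau>(1) F(3)] by metis
  have "aff_dim (closure \<tau>) = int DIM(real ^ 'a)"
    using aff_dim_nonempty_interior \<tau>(2,3) by metis
  then have h: "h = {x. a \<bullet> x = b}"
    using affine_hull_of_facet[OF _ F(3) _ ab(1)] ab(2) F(1) by auto
  then consider "b < a \<bullet> z" | "- b < (- a) \<bullet> z"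
    using assms(3) by fastforce
  then show ?thesis
    by cases (use that[of a b] that[of "-a" "-b"] ab(1) h in auto)
qed

lemma polys_continuous:
  assumes "p \<in> polys_deg_le k E"
  shows "continuous_on S p"
proof -
  obtain c where "p = (\<lambda>x. \<Sum>\<alpha>\<in>multi_indices k. (\<Prod>i\<in>UNIV. (x $ i) ^ \<alpha> i) *\<^sub>R c \<alpha>)"
    using assms by (auto simp: polys_deg_le_def fun_eq_iff)
  then show ?thesis by (simp only:) (intro continuous_intros)
qed

text \<open>
  A half-open cell contains boundary points of its element, so the polynomial has to describe the
  function there too; continuity provides this.
\<close>

lemma mesh_function_poly_on_closure:
  assumes "conforming_simplicial_mesh \<Omega> \<T>" "v \<in> mesh_functions \<Omega> \<T> k E" "\<tau> \<in> \<T>"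
  obtains p where "p \<in> polys_deg_le k E" "\<And>x. x \<in> closure \<tau> \<Longrightarrow> v x = p x"
proof -
  obtain p where p: "p \<in> polys_deg_le k E" "\<And>x. x \<in> \<tau> \<Longrightarrow> v x = p x"
    using assms(2,3) by (auto simp: mesh_functions_def)
  have "closure \<tau> \<subseteq> closure \<Omega>"
    using assms(1,3) by (auto simp: conforming_simplicial_mesh_def)
  then have "continuous_on (closure \<tau>) (\<lambda>x. v x - p x)"
    using assms(2) p(1) polys_continuous
    by (intro continuous_on_diff) (auto simp: mesh_functions_def intro: continuous_on_subset)
  then have "v x - p x = 0" if "x \<in> closure \<tau>" for x
    using continuous_constant_on_closure[of \<tau> "\<lambda>x. v x - p x" 0 x] p(2) that by auto
  with p(1) show ?thesis by (intro that) auto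
qed


section \<open>Partition into half-open cells\<close>

text \<open>
  The point \<open>p\<close> selects a side of each hyperplane.  With all normals pointing towards \<open>z\<close>, the
  constraint stays closed where \<open>p\<close> is on the side of \<open>z\<close> and becomes strict where it is not: the
  points of such a cell are those from which a short step towards \<open>z\<close> leads into the open polyhedron.
\<close>

definition half_open_cell ::
  "('h \<Rightarrow> 'a::real_inner) \<Rightarrow> ('h \<Rightarrow> real) \<Rightarrow> 'h set \<Rightarrow> 'a \<Rightarrow> 'a set" where
  "half_open_cell a b G p =
     {x. \<forall>g\<in>G. if b g < a g \<bullet> p then b g \<le> a g \<bullet> x else a g \<bullet> x < b g}"

text \<open>
  Here \<open>c\<close> and \<open>d\<close> are the values of an affine form at the two ends of a segment.  The asymmetry
  at \<open>c = 0\<close> is what makes the cells half-open.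
\<close>

lemma eventually_sign_towards_positive:
  fixes c d :: real
  assumes "0 < d"
  shows "0 \<le> c \<Longrightarrow> \<forall>\<^sub>F t in at_right 0. 0 < (1 - t) * c + t * d"
    and "c < 0 \<Longrightarrow> \<forall>\<^sub>F t in at_right 0. (1 - t) * c + t * d < 0"
proof -
  assume "0 \<le> c"
  have "\<forall>\<^sub>F t in at_right (0::real). t \<in> {0<..<1}"
    by (rule eventually_at_right_real) simp
  then show "\<forall>\<^sub>F t in at_right 0. 0 < (1 - t) * c + t * d"
    by eventually_elim (use \<open>0 \<le> c\<close> assms in \<open>auto intro: add_nonneg_pos\<close>)
next
  assume "c < 0"
  have "((\<lambda>t. (1 - t) * c + t * d) \<longlongrightarrow> (1 - 0) * c + 0 * d) (at_right 0)"
    by (intro tendsto_intros)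
  then show "\<forall>\<^sub>F t in at_right 0. (1 - t) * c + t * d < 0"
    using \<open>c < 0\<close> by (intro order_tendstoD(2)) auto
qed

lemma inner_towards:
  fixes x z :: "'a::real_inner"
  shows "a \<bullet> ((1 - t) *\<^sub>R x + t *\<^sub>R z) - b = (1 - t) * (a \<bullet> x - b) + t * (a \<bullet> z - b)"
  by (simp add: inner_right_distrib algebra_simps)

lemma half_open_cell_eventually_inside:
  assumes "finite G" "\<And>g. g \<in> G \<Longrightarrow> b g < a g \<bullet> z" "\<And>g. g \<in> G \<Longrightarrow> a g \<bullet> p \<noteq> b g"
    and "x \<in> half_open_cell a b G p"
  shows "\<forall>\<^sub>F t in at_right 0. \<forall>g\<in>G.
    0 < (a g \<bullet> p - b g) * (a g \<bullet> ((1 - t) *\<^sub>R x + t *\<^sub>R z) - b g)"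
proof (rule eventually_ball_finite[OF assms(1)], rule ballI)
  fix g assume g: "g \<in> G"
  have d: "0 < a g \<bullet> z - b g" using assms(2)[OF g] by simp
  show "\<forall>\<^sub>F t in at_right 0.
    0 < (a g \<bullet> p - b g) * (a g \<bullet> ((1 - t) *\<^sub>R x + t *\<^sub>R z) - b g)"
  proof (cases "b g < a g \<bullet> p")
    case True
    then have "0 \<le> a g \<bullet> x - b g"
      using assms(4) g by (auto simp: half_open_cell_def)
    from eventually_sign_towards_positive(1)[OF d this] show ?thesis
      by eventually_elim (use True in \<open>simp add: inner_towards\<close>)
  next
    case False
    then have "a g \<bullet> x - b g < 0" "a g \<bullet> p - b g < 0"
      using assms(3)[OF g] assms(4) g by (auto simp: half_open_cell_def)
    from eventually_sign_towards_positive(2)[OF d this(1)] show ?thesis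
      by eventually_elim (use \<open>a g \<bullet> p - b g < 0\<close> in \<open>simp add: inner_towards mult_neg_neg\<close>)
  qed
qed

lemma not_half_open_cell_eventually_outside:
  assumes "\<And>g. g \<in> G \<Longrightarrow> b g < a g \<bullet> z" "\<And>g. g \<in> G \<Longrightarrow> a g \<bullet> p \<noteq> b g"
    and "x \<notin> half_open_cell a b G p"
  shows "\<forall>\<^sub>F t in at_right 0. \<not> (\<forall>g\<in>G.
    0 \<le> (a g \<bullet> p - b g) * (a g \<bullet> ((1 - t) *\<^sub>R x + t *\<^sub>R z) - b g))"
proof -
  obtain g where g: "g \<in> G"
    "\<not> (if b g < a g \<bullet> p then b g \<le> a g \<bullet> x else a g \<bullet> x < b g)"
    using assms(3) by (auto simp: half_open_cell_def)
  have d: "0 < a g \<bullet> z - b g" using assms(1) g(1) by simp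
  show ?thesis
  proof (cases "b g < a g \<bullet> p")
    case True
    then have "a g \<bullet> x - b g < 0" using g by auto
    from eventually_sign_towards_positive(2)[OF d this] show ?thesis
      by eventually_elim
        (use True g(1) in \<open>auto simp: inner_towards zero_le_mult_iff not_le intro!: bexI[of _ g]\<close>)
  next
    case False
    then have "0 \<le> a g \<bullet> x - b g" "a g \<bullet> p - b g < 0" using g assms(2) by (auto simp: less_le)
    from eventually_sign_towards_positive(1)[OF d this(1)] show ?thesis
      by eventually_elim
        (use \<open>a g \<bullet> p - b g < 0\<close> g(1) in
          \<open>auto simp: inner_towards zero_le_mult_iff not_le intro!: bexI[of _ g]\<close>)
  qed
qed

text \<open>
  A short step from \<open>x\<close> towards \<open>z\<close> stays in the union of the closed elements, and it leads out of
  every closed element whose cell does not contain \<open>x\<close>; so some cell contains \<open>x\<close>.  If two did, the step would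
  lead into two disjoint open elements.
\<close>

lemma half_open_cells_partition:
  fixes z :: "'a::real_inner" and a :: "'h \<Rightarrow> 'a" and G :: "'a set \<Rightarrow> 'h set"
  assumes "finite \<T>" "pairwise disjnt \<T>"
    and G: "\<And>\<tau>. \<tau> \<in> \<T> \<Longrightarrow> finite (G \<tau>)"
      "\<And>\<tau> g. \<tau> \<in> \<T> \<Longrightarrow> g \<in> G \<tau> \<Longrightarrow> b g < a g \<bullet> z"
      "\<And>\<tau> g. \<tau> \<in> \<T> \<Longrightarrow> g \<in> G \<tau> \<Longrightarrow> a g \<bullet> p \<tau> \<noteq> b g"
    and sides: "\<And>\<tau>. \<tau> \<in> \<T> \<Longrightarrow>
        closure \<tau> = {x. \<forall>g\<in>G \<tau>. 0 \<le> (a g \<bullet> p \<tau> - b g) * (a g \<bullet> x - b g)}"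
      "\<And>\<tau>. \<tau> \<in> \<T> \<Longrightarrow> \<tau> = {x. \<forall>g\<in>G \<tau>. 0 < (a g \<bullet> p \<tau> - b g) * (a g \<bullet> x - b g)}"
    and segment: "\<And>t. 0 < t \<Longrightarrow> t < 1 \<Longrightarrow> (1 - t) *\<^sub>R x + t *\<^sub>R z \<in> (\<Union>\<tau>\<in>\<T>. closure \<tau>)"
  shows "\<exists>!\<tau>. \<tau> \<in> \<T> \<and> x \<in> half_open_cell a b (G \<tau>) (p \<tau>)"
proof -
  define y where "y t = (1 - t) *\<^sub>R x + t *\<^sub>R z" for t
  have inside: "\<forall>\<^sub>F t in at_right 0. y t \<in> \<tau>"
    if "\<tau> \<in> \<T>" "x \<in> half_open_cell a b (G \<tau>) (p \<tau>)" for \<tau>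
  proof -
    have "\<forall>\<^sub>F t in at_right 0. \<forall>g\<in>G \<tau>. 0 < (a g \<bullet> p \<tau> - b g) * (a g \<bullet> y t - b g)"
      unfolding y_def using that G by (intro half_open_cell_eventually_inside) auto
    then show ?thesis
      by eventually_elim (subst sides(2)[OF that(1)], simp)
  qed
  have outside: "\<forall>\<^sub>F t in at_right 0. y t \<notin> closure \<tau>"
    if "\<tau> \<in> \<T>" "x \<notin> half_open_cell a b (G \<tau>) (p \<tau>)" for \<tau>
    unfolding y_def sides(1)[OF that(1)] mem_Collect_eq
    using that G by (intro not_half_open_cell_eventually_outside) auto
  have "\<exists>\<tau>\<in>\<T>. x \<in> half_open_cell a b (G \<tau>) (p \<tau>)"
  proof (rule ccontr)
    assume "\<not> ?thesis"
    then have "\<forall>\<^sub>F t in at_right 0. \<forall>\<tau>\<in>\<T>. y t \<notin> closure \<tau>"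
      using outside assms(1) by (intro eventually_ball_finite) auto
    moreover have "\<forall>\<^sub>F t in at_right (0::real). t \<in> {0<..<1}"
      by (rule eventually_at_right_real) simp
    ultimately have "\<forall>\<^sub>F t in at_right (0::real). False"
      by eventually_elim (use segment in \<open>auto simp: y_def\<close>)
    then show False by (simp add: trivial_limit_at_right_real)
  qed
  moreover have "\<sigma> = \<tau>"
    if "\<sigma> \<in> \<T>" "x \<in> half_open_cell a b (G \<sigma>) (p \<sigma>)"
      "\<tau> \<in> \<T>" "x \<in> half_open_cell a b (G \<tau>) (p \<tau>)" for \<sigma> \<tau>
  proof -
    have "\<forall>\<^sub>F t in at_right 0. y t \<in> \<sigma> \<and> y t \<in> \<tau>"
      using inside that by (intro eventually_conj) auto
    then obtain t where "y t \<in> \<sigma>" "y t \<in> \<tau>"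
      using eventually_happens'[OF trivial_limit_at_right_real] by blast
    then show ?thesis
      using assms(2) that by (auto simp: pairwise_def disjnt_def)
  qed
  ultimately show ?thesis by blast
qed


section \<open>Neurons supported on a cell\<close>

lemma activation_linear:
  "activation 1 t - activation 1 (- t) = t"
  by (simp add: activation_def)

text \<open>
  Because all normals are oriented alike, the indicator of \<open>a g \<bullet> x < b g\<close> decides both kinds of
  constraint: it is the violation of a closed one and the complement of the violation of a strict one.  Hence the
  number of violated constraints is an affine combination of Heaviside neurons.
\<close>

lemma violated_constraints:
  fixes a :: "'h \<Rightarrow> 'a::real_inner" and b :: "'h \<Rightarrow> real" and p x :: 'a
  assumes "finite G"
  defines "viol \<equiv> (\<Sum>g\<in>G. if b g < a g \<bullet> p then activation 0 (b g - a g \<bullet> x)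
                            else 1 - activation 0 (b g - a g \<bullet> x))"
  shows "x \<in> half_open_cell a b G p \<Longrightarrow> viol = 0"
    and "x \<notin> half_open_cell a b G p \<Longrightarrow> 1 \<le> viol"
proof -
  let ?v = "\<lambda>g. if b g < a g \<bullet> p then activation 0 (b g - a g \<bullet> x)
                else 1 - activation 0 (b g - a g \<bullet> x)"
  show "viol = 0" if "x \<in> half_open_cell a b G p"
    unfolding viol_def
  proof (intro sum.neutral ballI)
    fix g assume "g \<in> G"
    with that have "if b g < a g \<bullet> p then b g \<le> a g \<bullet> x else a g \<bullet> x < b g"
      by (simp add: half_open_cell_def)
    then show "?v g = 0" by (auto simp: activation_def split: if_splits)
  qed
  assume "x \<notin> half_open_cell a b G p"
  then obtain g where g: "g \<in> G"
    "\<not> (if b g < a g \<bullet> p then b g \<le> a g \<bullet> x else a g \<bullet> x < b g)"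
    by (auto simp: half_open_cell_def)
  then have "?v g = 1" by (auto simp: activation_def split: if_splits)
  moreover have "?v g \<le> viol"
    unfolding viol_def using g(1) assms(1) by (intro member_le_sum) (auto simp: activation_def)
  ultimately show "1 \<le> viol" by simp
qed

text \<open>
  The penalty 2 for each violated constraint outweighs an affine form bounded by 2, and the positivity of
  the form makes the formula hold for \<open>k = 0\<close> as well.
\<close>

lemma activation_penalized:
  assumes "0 < l" "l \<le> 2" "in_cell \<Longrightarrow> viol = 0" "\<not> in_cell \<Longrightarrow> 1 \<le> viol"
  shows "activation k (l - 2 * viol) = (if in_cell then l ^ k else 0)"
  by (cases in_cell) (use assms in \<open>auto simp: activation_def max_def\<close>)

text \<open>
  Each hyperplane contributes two neurons, one for each orientation \<open>s\<close>.  The difference of their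
  ramps is the affine form \<open>a g \<bullet> x - b g\<close>, and since the normals span \<open>w\<close> these forms produce
  \<open>w \<bullet> x\<close> up to a constant.  The Heaviside output of the neuron with \<open>s = False\<close> is the indicator of
  \<open>a g \<bullet> x < b g\<close>, from which the penalty is formed.
\<close>

lemma ex_cell_neuron:
  fixes a :: "'h \<Rightarrow> 'a::real_inner" and b :: "'h \<Rightarrow> real"
  assumes "finite H" "G \<subseteq> H" "w \<in> span (a ` H)"
  defines "aff \<equiv> \<lambda>(g, s) x. (if s then a g else - a g) \<bullet> x + (if s then - b g else b g)"
  shows "\<exists>U V c. \<forall>x.
    (\<Sum>q\<in>H \<times> UNIV. U q * activation 0 (aff q x)) +
    (\<Sum>q\<in>H \<times> UNIV. V q * activation 1 (aff q x)) + c =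
    1 + w \<bullet> x - 2 * (\<Sum>g\<in>G. if b g < a g \<bullet> p then activation 0 (b g - a g \<bullet> x)
                            else 1 - activation 0 (b g - a g \<bullet> x))"
proof -
  obtain \<mu> where w: "w = (\<Sum>g\<in>H. \<mu> g *\<^sub>R a g)"
    using real_vector.span_image_family[OF assms(1,3)] .
  define U where "U = (\<lambda>(g, s). if s \<or> g \<notin> G then 0 else if b g < a g \<bullet> p then - 2 else (2::real))"
  define V where "V = (\<lambda>(g, s). if s then \<mu> g else - \<mu> g)"
  \<comment> \<open>Besides undoing the offsets \<open>b g\<close>, the bias charges every strict constraint as violated; the
      weight 2 in \<open>U\<close> takes the charge back when the constraint holds.\<close>
  define c where "c = 1 + (\<Sum>g\<in>H. \<mu> g * b g) - 2 * (\<Sum>g\<in>G. if b g < a g \<bullet> p then 0 else 1)"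
  have prod: "(\<Sum>q\<in>H \<times> UNIV. f q) = (\<Sum>g\<in>H. f (g, True) + f (g, False))"
    for f :: "'h \<times> bool \<Rightarrow> real"
    unfolding sum.cartesian_product'[symmetric] by (simp add: UNIV_bool sum.cartesian_product' add.commute)
  show ?thesis
  proof (intro exI allI)
    fix x
    let ?A = "\<lambda>g. activation 0 (b g - a g \<bullet> x)"
    have "(\<Sum>q\<in>H \<times> UNIV. U q * activation 0 (aff q x))
        = (\<Sum>g\<in>H. if g \<in> G then (if b g < a g \<bullet> p then - 2 else 2) * ?A g else 0)"
      unfolding prod by (intro sum.cong) (auto simp: U_def aff_def)
    also have "\<dots> = (\<Sum>g\<in>G. (if b g < a g \<bullet> p then - 2 else 2) * ?A g)"
      using assms(1,2) by (simp add: sum.inter_restrict[symmetric] Int_absorb1)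
    finally have U: "(\<Sum>q\<in>H \<times> UNIV. U q * activation 0 (aff q x)) = \<dots>" .
    have "(\<Sum>q\<in>H \<times> UNIV. V q * activation 1 (aff q x))
        = (\<Sum>g\<in>H. \<mu> g * (activation 1 (a g \<bullet> x - b g) - activation 1 (- (a g \<bullet> x - b g))))"
      unfolding prod by (intro sum.cong) (auto simp: V_def aff_def algebra_simps)
    also have "\<dots> = w \<bullet> x - (\<Sum>g\<in>H. \<mu> g * b g)"
      unfolding activation_linear
      by (simp add: w inner_sum_left sum_subtractf algebra_simps)
    finally have V: "(\<Sum>q\<in>H \<times> UNIV. V q * activation 1 (aff q x)) = \<dots>" .
    have "(\<Sum>g\<in>G. (if b g < a g \<bullet> p then - 2 else 2) * ?A g) - 2 * (\<Sum>g\<in>G. if b g < a g \<bullet> p then 0 else 1)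
        = - 2 * (\<Sum>g\<in>G. if b g < a g \<bullet> p then ?A g else 1 - ?A g)"
      unfolding sum_distrib_left sum_subtractf[symmetric] by (intro sum.cong) auto
    then show "(\<Sum>q\<in>H \<times> UNIV. U q * activation 0 (aff q x)) +
      (\<Sum>q\<in>H \<times> UNIV. V q * activation 1 (aff q x)) + c =
      1 + w \<bullet> x - 2 * (\<Sum>g\<in>G. if b g < a g \<bullet> p then ?A g else 1 - ?A g)"
      unfolding U V c_def by linarith
  qed
qed

text \<open>
  Layers indexed by arbitrary finite sets: this allows neurons to be indexed by hyperplanes with
  orientations, and by elements with directions, instead of by numbers.
\<close>

lemma network_of_families:
  fixes W1 :: "'p \<Rightarrow> real ^ 'd"
  assumes "finite P" "finite Q" "card P = n\<^sub>1" "card Q = n\<^sub>2"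
    and pre: "\<And>q x. q \<in> Q \<Longrightarrow> (\<Sum>p\<in>P. W20 q p * activation 0 (W1 p \<bullet> x + b1 p)) +
        (\<Sum>p\<in>P. W21 q p * activation 1 (W1 p \<bullet> x + b1 p)) + b2 q = pre q x"
  shows "\<exists>W1' b1' W20' W21' b2'. \<forall>m W3. \<exists>W3'. \<forall>x. \<forall>i<m.
    network m k n\<^sub>1 n\<^sub>2 W1' b1' W20' W21' b2' W3' x i = (\<Sum>q\<in>Q. W3 i q * activation k (pre q x))"
proof -
  obtain \<phi> \<psi> where \<phi>: "bij_betw \<phi> {..<n\<^sub>1} P" and \<psi>: "bij_betw \<psi> {..<n\<^sub>2} Q"
    using assms(1-4) ex_bij_betw_nat_finite by (metis lessThan_atLeast0)
  have "network m k n\<^sub>1 n\<^sub>2 (W1 \<circ> \<phi>) (b1 \<circ> \<phi>) (\<lambda>j l. W20 (\<psi> j) (\<phi> l)) (\<lambda>j l. W21 (\<psi> j) (\<phi> l))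
      (b2 \<circ> \<psi>) (\<lambda>i j. W3 i (\<psi> j)) x i = (\<Sum>q\<in>Q. W3 i q * activation k (pre q x))"
    if "i < m" for m W3 x and i :: nat
  proof -
    have "(\<Sum>q\<in>Q. W3 i q * activation k (pre q x)) = (\<Sum>q\<in>Q. W3 i q * activation k
        ((\<Sum>p\<in>P. W20 q p * activation 0 (W1 p \<bullet> x + b1 p)) +
         (\<Sum>p\<in>P. W21 q p * activation 1 (W1 p \<bullet> x + b1 p)) + b2 q))"
      by (intro sum.cong refl) (simp only: pre)
    then show ?thesis
      using that by (simp add: network_def sum.reindex_bij_betw[OF \<phi>, symmetric]
          sum.reindex_bij_betw[OF \<psi>, symmetric])
  qed
  then show ?thesis by (intro exI allI impI)
qed


section \<open>Realization of piecewise polynomials\<close>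

lemma abs_inner_le_coordinates:
  fixes w x :: "real ^ 'd" and \<delta> R :: real
  assumes "\<And>i. \<bar>w $ i\<bar> \<le> \<delta>" "norm x \<le> R"
  shows "\<bar>w \<bullet> x\<bar> \<le> CARD('d) * (\<delta> * R)"
proof -
  have "\<bar>w \<bullet> x\<bar> \<le> (\<Sum>i\<in>UNIV. \<bar>w $ i * x $ i\<bar>)"
    by (simp add: inner_vec_def)
  also have "\<dots> \<le> (\<Sum>i\<in>(UNIV :: 'd set). \<delta> * R)"
    unfolding abs_mult
    using assms(1) order_trans[OF component_le_norm_cart assms(2)] order_trans[OF abs_ge_zero assms(1)]
    by (intro sum_mono mult_mono) auto
  finally show ?thesis by simp
qed

theorem corollary14:
  fixes \<Omega> :: "(real ^ 'd) set" and \<T> :: "(real ^ 'd) set set" and z :: "real ^ 'd" and k :: nat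
  assumes "bounded \<Omega>" and "open \<Omega>" and "polyhedral \<Omega>"
    and "conforming_simplicial_mesh \<Omega> \<T>"
    and "z \<in> \<Omega>" and "\<forall>h\<in>mesh_hyperplanes \<T>. z \<notin> h"
    and "\<forall>x\<in>closure \<Omega>. \<forall>t::real. 0 < t \<and> t \<le> 1 \<longrightarrow> (1 - t) *\<^sub>R x + t *\<^sub>R z \<in> \<Omega>"
  shows "let H = card (mesh_hyperplanes \<T>); N = card \<T>; M = (CARD('d) + k) choose CARD('d) in
    \<exists>W1 b1 W20 W21 b2. \<forall>(E :: 'e::real_normed_vector set) m e.
      subspace E \<and> dim E = m \<and> 1 \<le> m \<and> ordered_basis E m e \<longrightarrow>
      (\<forall>v\<in>mesh_functions \<Omega> \<T> k E. \<exists>W3.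
         let F = network m k (2 * H) (M * N) W1 b1 W20 W21 b2 W3 in
         F \<in> NN m k (2 * H) (M * N) \<and>
         (\<forall>x\<in>closure \<Omega>. v x = (\<Sum>i<m. F x i *\<^sub>R e i)))"
proof -
  define \<H> where "\<H> = mesh_hyperplanes \<T>"
  define M where "M = (CARD('d) + k) choose CARD('d)"
  note mesh = \<open>conforming_simplicial_mesh \<Omega> \<T>\<close>
  have fin: "finite \<T>" "finite \<H>" and disj: "pairwise disjnt \<T>"
    and cover: "(\<Union>\<tau>\<in>\<T>. closure \<tau>) = closure \<Omega>"
    using mesh finite_mesh_hyperplanes[OF mesh]
    by (auto simp: conforming_simplicial_mesh_def \<H>_def)
  have "\<forall>h\<in>\<H>. \<exists>a b. a \<noteq> 0 \<and> h = {x. a \<bullet> x = b} \<and> b < a \<bullet> z"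
    using mesh_hyperplane_oriented[OF mesh] assms(6) unfolding \<H>_def by metis
  then obtain a b where ab: "\<And>h. h \<in> \<H> \<Longrightarrow> a h \<noteq> 0 \<and> h = {x. a h \<bullet> x = b h}"
    and z: "\<And>h. h \<in> \<H> \<Longrightarrow> b h < a h \<bullet> z"
    by metis
  define G where "G \<tau> = {affine hull F |F. F facet_of closure \<tau>}" for \<tau> :: "(real ^ 'd) set"
  have G_sub: "G \<tau> \<subseteq> \<H>" if "\<tau> \<in> \<T>" for \<tau>
    using that by (auto simp: G_def \<H>_def mesh_hyperplanes_def)
  have "\<forall>\<tau>\<in>\<T>. \<exists>p. p \<in> \<tau>" using mesh_element(3)[OF mesh] by blast
  then obtain p where p: "\<And>\<tau>. \<tau> \<in> \<T> \<Longrightarrow> p \<tau> \<in> \<tau>" by metis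
  have closed_sides: "closure \<tau> = {x. \<forall>g\<in>G \<tau>. 0 \<le> (a g \<bullet> p \<tau> - b g) * (a g \<bullet> x - b g)}"
    and open_sides: "\<tau> = {x. \<forall>g\<in>G \<tau>. 0 < (a g \<bullet> p \<tau> - b g) * (a g \<bullet> x - b g)}"
    if "\<tau> \<in> \<T>" for \<tau>
  proof -
    note \<tau> = mesh_element[OF mesh that]
    have "p \<tau> \<in> interior (closure \<tau>)" using \<tau>(2) p that by simp
    have "a g \<noteq> 0 \<and> g = {x. a g \<bullet> x = b g}" if "g \<in> G \<tau>" for g
      using ab G_sub[OF \<open>\<tau> \<in> \<T>\<close>] that by blast
    note sides = full_dim_polyhedron_sides[OF \<tau>(1) \<open>p \<tau> \<in> interior (closure \<tau>)\<close> G_def this]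
    show "closure \<tau> = {x. \<forall>g\<in>G \<tau>. 0 \<le> (a g \<bullet> p \<tau> - b g) * (a g \<bullet> x - b g)}"
      by (rule sides(1))
    show "\<tau> = {x. \<forall>g\<in>G \<tau>. 0 < (a g \<bullet> p \<tau> - b g) * (a g \<bullet> x - b g)}"
      using sides(2) unfolding \<tau>(2) .
  qed
  have p_off: "a g \<bullet> p \<tau> \<noteq> b g" if "\<tau> \<in> \<T>" "g \<in> G \<tau>" for \<tau> g
  proof -
    have "p \<tau> \<in> {x. \<forall>g\<in>G \<tau>. 0 < (a g \<bullet> p \<tau> - b g) * (a g \<bullet> x - b g)}"
      by (rule subsetD[OF equalityD1[OF open_sides[OF that(1)]] p[OF that(1)]])
    then show ?thesis using that(2) by auto
  qed
  define cell where "cell \<tau> = half_open_cell a b (G \<tau>) (p \<tau>)" for \<tau>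
  have cell_closure: "x \<in> closure \<tau>" if "\<tau> \<in> \<T>" "x \<in> cell \<tau>" for x \<tau>
    unfolding closed_sides[OF that(1)]
    using that(2) by (auto simp: cell_def half_open_cell_def zero_le_mult_iff split: if_splits)
  have partition: "\<exists>!\<tau>. \<tau> \<in> \<T> \<and> x \<in> cell \<tau>" if "x \<in> closure \<Omega>" for x
    unfolding cell_def
  proof (rule half_open_cells_partition[OF fin(1) disj _ _ _ closed_sides open_sides])
    show "finite (G \<tau>)" if "\<tau> \<in> \<T>" for \<tau>
      using G_sub[OF that] fin(2) by (rule finite_subset)
    show "b g < a g \<bullet> z" if "\<tau> \<in> \<T>" "g \<in> G \<tau>" for \<tau> g
      using z G_sub that by blast
    show "(1 - t) *\<^sub>R x + t *\<^sub>R z \<in> (\<Union>\<tau>\<in>\<T>. closure \<tau>)" if "0 < t" "t < 1" for t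
      unfolding cover using assms(7) \<open>x \<in> closure \<Omega>\<close> that closure_subset by (meson less_imp_le subsetD)
  qed (use p_off in auto)
  have normals: "span (a ` \<H>) = UNIV" if "\<tau> \<in> \<T>" for \<tau>
  proof -
    have "span (a ` G \<tau>) = UNIV"
      by (rule bounded_normals_span[OF bounded_subset[OF mesh_element(4)[OF mesh that]
            equalityD2[OF closed_sides[OF that]]]])
    then show ?thesis using span_mono[OF image_mono[OF G_sub[OF that]], of a] by auto
  qed
  obtain R where R: "0 < R" "\<And>x. x \<in> closure \<Omega> \<Longrightarrow> norm x \<le> R"
    using bounded_closure[OF assms(1)] unfolding bounded_pos by blast
  \<comment> \<open>With this bound on the coordinates of \<open>w\<close> one has \<open>\<bar>w \<bullet> x\<bar> \<le> 1 / 2\<close> on the closed domain.\<close>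
  define \<delta> where "\<delta> = 1 / (2 * CARD('d) * R)"
  have "0 < \<delta>" using R(1) by (simp add: \<delta>_def)
  have "\<exists>w :: nat \<Rightarrow> real ^ 'd. (\<forall>j i. \<bar>w j $ i\<bar> \<le> \<delta>) \<and>
      (\<forall>\<alpha>\<in>multi_indices k. \<exists>c. \<forall>x. monomial \<alpha> x = (\<Sum>j<M. c j * (1 + w j \<bullet> x) ^ k))"
    unfolding M_def by (rule ex_affine_powers_spanning_monomials[OF \<open>0 < \<delta>\<close>])
  then obtain w :: "nat \<Rightarrow> real ^ 'd" where w: "\<forall>j i. \<bar>w j $ i\<bar> \<le> \<delta>"
    and powers: "\<forall>\<alpha>\<in>multi_indices k. \<exists>c. \<forall>x.
      monomial \<alpha> x = (\<Sum>j<M. c j * (1 + w j \<bullet> x) ^ k)"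
    by (elim exE conjE)
  have small: "\<bar>w j \<bullet> x\<bar> \<le> 1 / 2" if "x \<in> closure \<Omega>" for j x
    using abs_inner_le_coordinates[OF w[rule_format] R(2)[OF that]] R(1) by (simp add: \<delta>_def)
  \<comment> \<open>The first layer: both orientations of every mesh hyperplane.\<close>
  define W where "W = (\<lambda>(g, s). if s then a g else - a g)"
  define \<beta> where "\<beta> = (\<lambda>(g, s). if s then - b g else b g)"
  define pre where "pre \<tau> j x = 1 + w j \<bullet> x - 2 * (\<Sum>g\<in>G \<tau>.
      if b g < a g \<bullet> p \<tau> then activation 0 (b g - a g \<bullet> x) else 1 - activation 0 (b g - a g \<bullet> x))"
    for \<tau> j x
  \<comment> \<open>Named predicates keep the choice of parameters for each neuron, and of coefficients for each
      element, first-order.\<close>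
  define realizes where "realizes \<tau> j U V c \<longleftrightarrow>
      (\<forall>x. (\<Sum>q\<in>\<H> \<times> UNIV. U q * activation 0 (W q \<bullet> x + \<beta> q)) +
      (\<Sum>q\<in>\<H> \<times> UNIV. V q * activation 1 (W q \<bullet> x + \<beta> q)) + c = pre \<tau> j x)" for \<tau> j U V c
  have "\<exists>U V c. realizes \<tau> j U V c" if "\<tau> \<in> \<T>" for \<tau> j
    using ex_cell_neuron[OF fin(2) G_sub[OF that], of "w j" a b "p \<tau>"] normals[OF that]
    by (simp add: realizes_def pre_def W_def \<beta>_def case_prod_beta)
  then obtain U V c where UVc: "\<And>\<tau> j. \<tau> \<in> \<T> \<Longrightarrow> realizes \<tau> j (U \<tau> j) (V \<tau> j) (c \<tau> j)"
    by metis
  have neuron: "activation k (pre \<tau> j x) = (if x \<in> cell \<tau> then (1 + w j \<bullet> x) ^ k else 0)"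
    if "\<tau> \<in> \<T>" "x \<in> closure \<Omega>" for \<tau> j x
    unfolding pre_def
  proof (rule activation_penalized)
    show "0 < 1 + w j \<bullet> x" "1 + w j \<bullet> x \<le> 2" using small[OF that(2), of j] by (auto simp: abs_le_iff)
  qed (use violated_constraints[of "G \<tau>"] finite_subset[OF G_sub[OF that(1)] fin(2)]
        in \<open>auto simp: cell_def\<close>)
  have "\<exists>W1 b1 W20 W21 b2. \<forall>m W3. \<exists>W3'. \<forall>x. \<forall>i<m.
      network m k (2 * card \<H>) (M * card \<T>) W1 b1 W20 W21 b2 W3' x i =
       (\<Sum>q\<in>\<T> \<times> {..<M}. W3 i q * activation k (pre (fst q) (snd q) x))"
  proof (rule network_of_families)
    show "card (\<H> \<times> (UNIV :: bool set)) = 2 * card \<H>" "card (\<T> \<times> {..<M}) = M * card \<T>"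
      by (simp_all add: card_cartesian_product)
    show "(\<Sum>h\<in>\<H> \<times> UNIV. U (fst q) (snd q) h * activation 0 (W h \<bullet> x + \<beta> h)) +
         (\<Sum>h\<in>\<H> \<times> UNIV. V (fst q) (snd q) h * activation 1 (W h \<bullet> x + \<beta> h)) +
         c (fst q) (snd q) = pre (fst q) (snd q) x" if "q \<in> \<T> \<times> {..<M}" for q x
      using UVc[of "fst q" "snd q"] that unfolding realizes_def by auto
  qed (use fin in auto)
  then obtain W1 b1 W20 W21 b2 where net: "\<forall>m W3. \<exists>W3'. \<forall>x. \<forall>i<m.
      network m k (2 * card \<H>) (M * card \<T>) W1 b1 W20 W21 b2 W3' x i =
       (\<Sum>q\<in>\<T> \<times> {..<M}. W3 i q * activation k (pre (fst q) (snd q) x))"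
    by (elim exE)
  have "\<exists>W3. \<forall>x\<in>closure \<Omega>. v x =
      (\<Sum>i<m. network m k (2 * card \<H>) (M * card \<T>) W1 b1 W20 W21 b2 W3 x i *\<^sub>R e i)"
    if e: "ordered_basis E m e" and v: "v \<in> mesh_functions \<Omega> \<T> k E"
    for E :: "'e set" and m e v
  proof -
    define agrees where "agrees \<tau> C \<longleftrightarrow>
        (\<forall>x\<in>closure \<tau>. v x = (\<Sum>i<m. (\<Sum>j<M. C i j * (1 + w j \<bullet> x) ^ k) *\<^sub>R e i))" for \<tau> C
    have "\<exists>C. agrees \<tau> C" if "\<tau> \<in> \<T>" for \<tau>
    proof -
      obtain f where f: "f \<in> polys_deg_le k E" "\<And>x. x \<in> closure \<tau> \<Longrightarrow> v x = f x"
        using mesh_function_poly_on_closure[OF mesh v \<open>\<tau> \<in> \<T>\<close>] by blast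
      have "\<exists>C. \<forall>x. f x = (\<Sum>i<m. (\<Sum>j<M. C i j * (1 + w j \<bullet> x) ^ k) *\<^sub>R e i)"
        by (rule poly_as_affine_powers[OF powers[rule_format] e f(1)])
      with f(2) show ?thesis by (auto simp: agrees_def)
    qed
    then obtain C where C: "\<And>\<tau>. \<tau> \<in> \<T> \<Longrightarrow> agrees \<tau> (C \<tau>)" by metis
    from net[rule_format, of m "\<lambda>i q. C (fst q) i (snd q)"]
    obtain W3 where W3: "\<forall>x. \<forall>i<m. network m k (2 * card \<H>) (M * card \<T>) W1 b1 W20 W21 b2 W3 x i =
       (\<Sum>q\<in>\<T> \<times> {..<M}. C (fst q) i (snd q) * activation k (pre (fst q) (snd q) x))"
      by (rule exE)
    have "v x = (\<Sum>i<m. network m k (2 * card \<H>) (M * card \<T>) W1 b1 W20 W21 b2 W3 x i *\<^sub>R e i)"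
      if x: "x \<in> closure \<Omega>" for x
    proof -
      obtain \<tau> where \<tau>: "\<tau> \<in> \<T>" "x \<in> cell \<tau>" and uniq: "\<And>\<sigma>. \<sigma> \<in> \<T> \<Longrightarrow> x \<in> cell \<sigma> \<Longrightarrow> \<sigma> = \<tau>"
        using partition[OF x] by blast
      have "network m k (2 * card \<H>) (M * card \<T>) W1 b1 W20 W21 b2 W3 x i
          = (\<Sum>j<M. C \<tau> i j * (1 + w j \<bullet> x) ^ k)" if "i < m" for i
      proof -
        have "network m k (2 * card \<H>) (M * card \<T>) W1 b1 W20 W21 b2 W3 x i
            = (\<Sum>\<sigma>\<in>\<T>. \<Sum>j<M. C \<sigma> i j * activation k (pre \<sigma> j x))"
          unfolding W3[rule_format, OF that] sum.cartesian_product by (intro sum.cong) auto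
        also have "\<dots> = (\<Sum>\<sigma>\<in>\<T>. if \<sigma> = \<tau> then \<Sum>j<M. C \<tau> i j * (1 + w j \<bullet> x) ^ k else 0)"
        proof (rule sum.cong)
          fix \<sigma> assume \<sigma>: "\<sigma> \<in> \<T>"
          then have "x \<in> cell \<sigma> \<longleftrightarrow> \<sigma> = \<tau>" using \<tau>(2) uniq by blast
          then show "(\<Sum>j<M. C \<sigma> i j * activation k (pre \<sigma> j x))
              = (if \<sigma> = \<tau> then \<Sum>j<M. C \<tau> i j * (1 + w j \<bullet> x) ^ k else 0)"
            unfolding neuron[OF \<sigma> x] by simp
        qed simp
        finally show ?thesis using fin(1) \<tau>(1) by simp
      qed
      then show ?thesis
        using C[OF \<tau>(1)] cell_closure[OF \<tau>] by (simp add: agrees_def)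
    qed
    then show ?thesis by blast
  qed
  moreover have "network m k n\<^sub>1 n\<^sub>2 W1 b1 W20 W21 b2 W3 \<in> NN m k n\<^sub>1 n\<^sub>2" for m n\<^sub>1 n\<^sub>2 W3
    unfolding NN_def by blast
  ultimately show ?thesis
    unfolding Let_def \<H>_def[symmetric] M_def[symmetric]
    by (intro exI[of _ W1] exI[of _ b1] exI[of _ W20] exI[of _ W21] exI[of _ b2]) blast
qed

end
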